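(* Let $n,a,b,e$ be integers with $e>0$ and $a=2b+e$, and suppose $n=\mathrm{Even}\bigl(\tfrac{2b}{e}\bigr)$. Let $P_{n+1}$ be the path with vertices $v_0,\dots,v_n$ and edges $v_iv_{i+1}$ ($0\le i\le n-1$). Let $L$ be a $1$-reduced list of $P_{n+1}$, that is, $L$ assigns to each $v_i$ a finite set $L(i)\subset\mathbb{N}$ such that $|L(0)|=b$, $|L(i)|=a$ for all $i\in\{1,\dots,n-2\}$, $|L(n-1)|=|L(n)|=b+e$, and $|L(n-1)\cup L(n)|\ge 2b$. Then $P_{n+1}$ is $(L,b)$-choosable: there exist sets $c(i)\subset L(i)$ with $|c(i)|=b$ for all $i$ and $c(i)\cap c(i+1)=\emptyset$ for all $i\in\{0,\dots,n-1\}$.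
   Context: $\mathrm{Even}(x)$ denotes the smallest even integer $p$ with $p\ge x$. For a graph $G$, a list $L$ is a map $V(G)\to\mathcal{P}(\mathbb{N})$; $G$ is $(L,b)$-choosable if one can choose for each vertex $v$ a subset $c(v)\subset L(v)$ of size $b$ such that adjacent vertices receive disjoint subsets. *)

theory Defs
  imports Complex_Main
begin

definition Even :: "real \<Rightarrow> int" where
  "Even x = (LEAST p. even p \<and> x \<le> real_of_int p)"

(* LEAST on int is only meaningful when the set is bounded below; here it is. *)
lemma Even_eq: "Even x = 2 * \<lceil>x / 2\<rceil>"
  unfolding Even_def
proof (rule Least_equality)
  show "even (2 * \<lceil>x / 2\<rceil>) \<and> x \<le> real_of_int (2 * \<lceil>x / 2\<rceil>)"
    using le_of_int_ceiling[of "x / 2"] by (simp, linarith)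
next
  fix p :: int
  assume p: "even p \<and> x \<le> real_of_int p"
  then obtain k where k: "p = 2 * k" by (auto elim: evenE)
  with p have "x / 2 \<le> real_of_int k" by simp
  then show "2 * \<lceil>x / 2\<rceil> \<le> p" using k by (simp add: ceiling_le_iff)
qed

(* A graph is a pair of a vertex set and a set of edges, each edge a two-element set
   of vertices. *)
type_synonym 'v graph = "'v set \<times> 'v set set"

definition verts :: "'v graph \<Rightarrow> 'v set" where
  "verts G = fst G"

definition adjacent :: "'v graph \<Rightarrow> 'v \<Rightarrow> 'v \<Rightarrow> bool" where
  "adjacent G u v \<longleftrightarrow> {u, v} \<in> snd G"

(* P_m, the path on the m vertices 0, ..., m - 1. *)
definition path_graph :: "int \<Rightarrow> int graph" where
  "path_graph m = ({0..m - 1}, {{i, i + 1} | i. 0 \<le> i \<and> i + 1 \<le> m - 1})"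

(* A list is a map L from vertices to sets of naturals; only its values on verts G matter.
   Finiteness of c v is explicit because card is 0 on infinite sets. *)
definition choosable :: "'v graph \<Rightarrow> ('v \<Rightarrow> nat set) \<Rightarrow> int \<Rightarrow> bool" where
  "choosable G L b \<longleftrightarrow>
     (\<exists>c. (\<forall>v\<in>verts G. c v \<subseteq> L v \<and> finite (c v) \<and> int (card (c v)) = b) \<and>
          (\<forall>u\<in>verts G. \<forall>v\<in>verts G. adjacent G u v \<longrightarrow> c u \<inter> c v = {}))"

(* 1-reduced lists of P_(n+1). For n = 0 the conditions on L 0 and L n exclude each other
   (when e > 0), so the out-of-range index n - 1 = -1 is harmless. *)
definition one_reduced_list :: "int \<Rightarrow> int \<Rightarrow> int \<Rightarrow> int \<Rightarrow> (int \<Rightarrow> nat set) \<Rightarrow> bool" where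
  "one_reduced_list n a b e L \<longleftrightarrow>
     (\<forall>i\<in>verts (path_graph (n + 1)). finite (L i)) \<and>
     int (card (L 0)) = b \<and>
     (\<forall>i\<in>{1..n - 2}. int (card (L i)) = a) \<and>
     int (card (L (n - 1))) = b + e \<and>
     int (card (L n)) = b + e \<and>
     int (card (L (n - 1) \<union> L n)) \<ge> 2 * b"

lemma choosable_path_graph:
  "choosable (path_graph (n + 1)) L b \<longleftrightarrow>
     (\<exists>c. (\<forall>i\<in>{0..n}. c i \<subseteq> L i \<and> finite (c i) \<and> int (card (c i)) = b) \<and>
          (\<forall>i\<in>{0..n - 1}. c i \<inter> c (i + 1) = {}))"
proof -
  have "(\<forall>u\<in>{0..n}. \<forall>v\<in>{0..n}. adjacent (path_graph (n + 1)) u v \<longrightarrow> c u \<inter> c v = {}) \<longleftrightarrow>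
        (\<forall>i\<in>{0..n - 1}. c i \<inter> c (i + 1) = {})" for c :: "int \<Rightarrow> nat set"
    unfolding adjacent_def path_graph_def by (fastforce simp: doubleton_eq_iff)
  then show ?thesis
    unfolding choosable_def by (simp add: verts_def path_graph_def)
qed

end

(* Fix c(0) = L(0) and propagate along the path the family of possible values of c(i). By
   induction there is a set D of size b such that every b-set c with |D \<inter> c| \<le> k e can be
   put next to some admissible c(2k): one step turns this into the same statement with a set
   of size b + e and bound (k + 1) e, and the next step returns to size b with that bound.
   For n = 2m we have (m - 1) e \<ge> b - e, so it suffices to find c(n - 1) in L(n - 1) with at
   least min e b elements outside D and at least b - min e b elements outside L(n). *)

theory Submission
  imports Defs
begin

text \<open>Only the set at the last vertex \<open>i\<close> is exposed, because extending a
  colouring by one vertex depends on nothing else.\<close>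

definition path_colouring_end :: "(nat \<Rightarrow> 'a set) \<Rightarrow> nat \<Rightarrow> nat \<Rightarrow> 'a set \<Rightarrow> bool" where
  "path_colouring_end L b i S \<longleftrightarrow>
     (\<exists>c. (\<forall>j\<le>i. c j \<subseteq> L j \<and> finite (c j) \<and> card (c j) = b) \<and>
          (\<forall>j<i. c j \<inter> c (Suc j) = {}) \<and> c i = S)"

lemma path_colouring_end_0:
  "finite (L 0) \<Longrightarrow> card (L 0) = b \<Longrightarrow> path_colouring_end L b 0 (L 0)"
  unfolding path_colouring_end_def by (intro exI[of _ L]) auto

lemma path_colouring_end_Suc:
  assumes "path_colouring_end L b i S"
    and "T \<subseteq> L (Suc i)" "finite T" "card T = b" "S \<inter> T = {}"
  shows "path_colouring_end L b (Suc i) T"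
proof -
  obtain c where c: "\<forall>j\<le>i. c j \<subseteq> L j \<and> finite (c j) \<and> card (c j) = b"
    "\<forall>j<i. c j \<inter> c (Suc j) = {}" "c i = S"
    using assms(1) unfolding path_colouring_end_def by blast
  show ?thesis
    unfolding path_colouring_end_def
    by (rule exI[of _ "c(Suc i := T)"])
      (use c assms(2-) in \<open>auto simp: le_Suc_eq less_Suc_eq\<close>)
qed

text \<open>One step along the path: a bound \<open>s\<close> on the overlap with \<open>B\<close>
  is traded for the bound \<open>s + \<gamma> - b\<close> on the overlap with \<open>C\<close>. Take
  \<open>C\<close> in \<open>L\<close> outside \<open>B\<close> and let \<open>S\<close> use
  \<open>C - c\<close> first. Only the elements of \<open>S\<close> outside \<open>C - c\<close> can
  lie in \<open>B\<close>, and there are at most \<open>s\<close> of them, since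
  \<open>C - c\<close> has at least \<open>b - s\<close> elements.\<close>

lemma exchange_step:
  fixes b s \<beta> \<gamma> :: nat
  assumes "finite L" "card L = \<beta> + \<gamma>" "finite B" "card B = \<beta>" "b \<le> \<beta>" "b \<le> \<gamma>"
  obtains C where "finite C" "card C = \<gamma>"
    "\<And>c. finite c \<Longrightarrow> card c = b \<Longrightarrow> card (C \<inter> c) + b \<le> s + \<gamma> \<Longrightarrow>
       \<exists>S\<subseteq>L. finite S \<and> card S = b \<and> S \<inter> c = {} \<and> card (B \<inter> S) \<le> s"
proof -
  have "\<gamma> \<le> card (L - B)"
    using diff_card_le_card_Diff[OF assms(3), of L] assms by simp
  then obtain C where C: "C \<subseteq> L - B" "card C = \<gamma>" "finite C"
    using obtain_subset_with_card_n by metis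
  have "\<exists>S\<subseteq>L. finite S \<and> card S = b \<and> S \<inter> c = {} \<and> card (B \<inter> S) \<le> s"
    if c: "finite c" "card c = b" "card (C \<inter> c) + b \<le> s + \<gamma>" for c
  proof (cases "b \<le> card (C - c)")
    case True
    then obtain S where S: "S \<subseteq> C - c" "card S = b" "finite S"
      using obtain_subset_with_card_n by metis
    then have "B \<inter> S = {}" "S \<subseteq> L" "S \<inter> c = {}" using C by auto
    then show ?thesis using S by auto
  next
    case False
    have "b \<le> card (L - c)"
      using diff_card_le_card_Diff[OF c(1), of L] c assms by simp
    then obtain S where S: "C - c \<subseteq> S" "S \<subseteq> L - c" "card S = b"
      using exists_subset_between[of "C - c" b "L - c"] False C assms(1) by auto
    have fS: "finite S" using S assms(1) finite_subset by blast
    have "card (B \<inter> S) \<le> card (S - (C - c))"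
      using C S fS by (intro card_mono) auto
    also have "\<dots> = b - card (C - c)"
      using S C by (simp add: card_Diff_subset)
    also have "\<dots> \<le> s"
      using card_Diff_subset_Int[of C c] C c by simp
    finally show ?thesis using S fS by (intro exI[of _ S]) auto
  qed
  then show thesis using that C by blast
qed

text \<open>A single set \<open>D\<close> summarises all colourings of the first
  \<open>2 * k + 1\<close> vertices; every two further vertices relax the condition on
  \<open>c\<close> by \<open>e\<close>.\<close>

lemma path_colouring_end_avoiding:
  fixes b e :: nat
  assumes "finite (L 0)" "card (L 0) = b"
    and "\<And>i. 1 \<le> i \<Longrightarrow> i \<le> 2 * k \<Longrightarrow> finite (L i) \<and> card (L i) = 2 * b + e"
  shows "\<exists>D. finite D \<and> card D = b \<and>
    (\<forall>c. finite c \<and> card c = b \<and> card (D \<inter> c) \<le> k * e \<longrightarrow>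
      (\<exists>S. path_colouring_end L b (2 * k) S \<and> S \<inter> c = {}))"
  using assms(3)
proof (induction k)
  case 0
  \<comment> \<open>With bound 0, \<open>c\<close> is disjoint from \<open>L 0\<close>, so the only
    colouring of the first vertex already works.\<close>
  show ?case
    using assms(1,2) path_colouring_end_0 by (intro exI[of _ "L 0"]) auto
next
  case (Suc k)
  then obtain D where D: "finite D" "card D = b"
    and extend: "\<And>c. finite c \<Longrightarrow> card c = b \<Longrightarrow> card (D \<inter> c) \<le> k * e \<Longrightarrow>
      \<exists>S. path_colouring_end L b (2 * k) S \<and> S \<inter> c = {}"
    by fastforce
  let ?i = "Suc (2 * k)"
  \<comment> \<open>The two splittings of \<open>2 * b + e\<close> set \<open>\<gamma>\<close> to
    \<open>b + e\<close> and then to \<open>b\<close>, so the first exchange raises the bound by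
    \<open>e\<close> and the second keeps it.\<close>
  have L1: "finite (L ?i)" "card (L ?i) = b + (b + e)"
    and L2: "finite (L (Suc ?i))" "card (L (Suc ?i)) = b + e + b"
    using Suc.prems[of ?i] Suc.prems[of "Suc ?i"] by auto
  obtain A where A: "finite A" "card A = b + e"
    and stepA: "\<And>c. finite c \<Longrightarrow> card c = b \<Longrightarrow> card (A \<inter> c) + b \<le> k * e + (b + e) \<Longrightarrow>
      \<exists>S\<subseteq>L ?i. finite S \<and> card S = b \<and> S \<inter> c = {} \<and> card (D \<inter> S) \<le> k * e"
    by (rule exchange_step[OF L1 D, of b "k * e"]) auto
  obtain D' where D': "finite D'" "card D' = b"
    and stepD': "\<And>c. finite c \<Longrightarrow> card c = b \<Longrightarrow> card (D' \<inter> c) + b \<le> Suc k * e + b \<Longrightarrow>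
      \<exists>S\<subseteq>L (Suc ?i). finite S \<and> card S = b \<and> S \<inter> c = {} \<and> card (A \<inter> S) \<le> Suc k * e"
    by (rule exchange_step[OF L2 A, of b "Suc k * e"]) auto
  have "\<exists>S. path_colouring_end L b (2 * Suc k) S \<and> S \<inter> c = {}"
    if c: "finite c" "card c = b" "card (D' \<inter> c) \<le> Suc k * e" for c
  proof -
    \<comment> \<open>The sets are chosen backwards from \<open>c\<close>: each one meets the
      overlap bound needed to find its predecessor.\<close>
    obtain S2 where S2: "S2 \<subseteq> L (Suc ?i)" "finite S2" "card S2 = b" "S2 \<inter> c = {}"
      "card (A \<inter> S2) \<le> Suc k * e"
      using stepD'[of c] c by auto
    obtain S1 where S1: "S1 \<subseteq> L ?i" "finite S1" "card S1 = b" "S1 \<inter> S2 = {}"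
      "card (D \<inter> S1) \<le> k * e"
      using stepA[of S2] S2 by auto
    obtain S0 where S0: "path_colouring_end L b (2 * k) S0" "S0 \<inter> S1 = {}"
      using extend[of S1] S1 by auto
    have "path_colouring_end L b (Suc ?i) S2"
      using S0 S1 S2 path_colouring_end_Suc by metis
    then show ?thesis using S2 by auto
  qed
  then show ?case using D' by blast
qed

text \<open>The set \<open>S\<close> at the last but one vertex must overlap little with
  \<open>D\<close>, to be reachable from the left, and little with the last list, to leave
  \<open>b\<close> colours there. Subsets \<open>E\<close> and \<open>F\<close> of \<open>S\<close>
  secure these two demands.\<close>

lemma path_colouring_end_exists:
  fixes b e k :: nat
  assumes "finite (L 0)" "card (L 0) = b"
    and "\<And>i. 1 \<le> i \<Longrightarrow> i \<le> 2 * k \<Longrightarrow> finite (L i) \<and> card (L i) = 2 * b + e"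
    and X: "finite (L (Suc (2 * k)))" "card (L (Suc (2 * k))) = b + e"
    and Y: "finite (L (Suc (Suc (2 * k))))" "card (L (Suc (Suc (2 * k)))) = b + e"
    and XY: "2 * b \<le> card (L (Suc (2 * k)) \<union> L (Suc (Suc (2 * k))))"
    and "b \<le> Suc k * e"
  shows "\<exists>S. path_colouring_end L b (Suc (Suc (2 * k))) S"
proof -
  let ?X = "L (Suc (2 * k))" and ?Y = "L (Suc (Suc (2 * k)))"
  obtain D where D: "finite D" "card D = b"
    and extend: "\<And>c. finite c \<Longrightarrow> card c = b \<Longrightarrow> card (D \<inter> c) \<le> k * e \<Longrightarrow>
      \<exists>S. path_colouring_end L b (2 * k) S \<and> S \<inter> c = {}"
    using path_colouring_end_avoiding[of L b k e, OF assms(1-3)] by blast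
  \<comment> \<open>The minimum covers the case \<open>b < e\<close>, where \<open>E\<close> alone
    fills \<open>S\<close> and \<open>F\<close> is empty.\<close>
  have "min e b \<le> card (?X - D)"
    using diff_card_le_card_Diff[OF D(1), of ?X] D X by simp
  then obtain E where E: "E \<subseteq> ?X - D" "card E = min e b" "finite E"
    using obtain_subset_with_card_n by metis
  have "?X - ?Y = (?X \<union> ?Y) - ?Y" by blast
  then have "card (?X - ?Y) = card (?X \<union> ?Y) - (b + e)"
    using Y by (metis Un_upper2 card_Diff_subset)
  then have "b - min e b \<le> card (?X - ?Y)"
    using XY by simp
  then obtain F where F: "F \<subseteq> ?X - ?Y" "card F = b - min e b" "finite F"
    using obtain_subset_with_card_n by metis
  \<comment> \<open>The sizes of \<open>E\<close> and \<open>F\<close> add up to \<open>b\<close>,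
    so both fit into \<open>S\<close> even when disjoint.\<close>
  have "card (E \<union> F) \<le> b"
    using card_Un_le[of E F] E F by simp
  then obtain S where S: "E \<union> F \<subseteq> S" "S \<subseteq> ?X" "card S = b"
    using exists_subset_between[of "E \<union> F" b ?X] E F X by auto
  have fS: "finite S" using S X finite_subset by blast
  have "card (D \<inter> S) \<le> card (S - E)"
    using E fS by (intro card_mono) auto
  also have "\<dots> = b - min e b"
    using S E by (simp add: card_Diff_subset)
  also have "\<dots> \<le> k * e"
    using assms(9) by simp
  finally obtain S0 where "path_colouring_end L b (2 * k) S0" "S0 \<inter> S = {}"
    using extend[of S] fS S by blast
  then have end1: "path_colouring_end L b (Suc (2 * k)) S"
    using path_colouring_end_Suc S fS by metis
  \<comment> \<open>As \<open>F\<close> misses \<open>?Y\<close>, \<open>S\<close> removes at most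
    \<open>e\<close> of its \<open>b + e\<close> colours.\<close>
  have "card (?Y \<inter> S) \<le> card (S - F)"
    using F fS by (intro card_mono) auto
  also have "\<dots> = min e b"
    using S F by (simp add: card_Diff_subset)
  finally have "b \<le> card (?Y - S)"
    using card_Diff_subset_Int[of ?Y S] Y by (simp, linarith)
  then obtain T where "T \<subseteq> ?Y - S" "card T = b" "finite T"
    using obtain_subset_with_card_n by metis
  then have "path_colouring_end L b (Suc (Suc (2 * k))) T"
    by (intro path_colouring_end_Suc[OF end1]) auto
  then show ?thesis ..
qed

theorem theorem2p2:
  fixes n a b e :: int and L :: "int \<Rightarrow> nat set"
  assumes "e > 0"
    and "a = 2 * b + e"
    and "n = Even (2 * real_of_int b / real_of_int e)"
    and "one_reduced_list n a b e L"
  shows "choosable (path_graph (n + 1)) L b"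
proof -
  have fin: "\<And>i. 0 \<le> i \<Longrightarrow> i \<le> n \<Longrightarrow> finite (L i)"
    and L0: "int (card (L 0)) = b"
    and Lmid: "\<And>i. 1 \<le> i \<Longrightarrow> i \<le> n - 2 \<Longrightarrow> int (card (L i)) = a"
    and Ln: "int (card (L (n - 1))) = b + e" "int (card (L n)) = b + e"
    and Lun: "int (card (L (n - 1) \<union> L n)) \<ge> 2 * b"
    using assms(4) by (auto simp: one_reduced_list_def verts_def path_graph_def)
  define m where "m = \<lceil>real_of_int b / real_of_int e\<rceil>"
  have n: "n = 2 * m"
    unfolding assms(3) Even_eq m_def by simp
  \<comment> \<open>If \<open>b = 0\<close> then \<open>n = 0\<close>, and \<open>L 0\<close> would
    have both size 0 and size \<open>e > 0\<close>.\<close>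
  have "b \<noteq> 0"
    using L0 Ln(2) assms(1) n by (auto simp: m_def)
  then have "b > 0" using L0 by simp
  then have "m \<ge> 1"
    using assms(1) by (simp add: m_def le_ceiling_iff)
  have "real_of_int b / real_of_int e \<le> real_of_int m"
    unfolding m_def by (rule le_of_int_ceiling)
  then have "real_of_int b \<le> real_of_int (m * e)"
    using assms(1) by (simp add: divide_le_eq)
  then have be: "b \<le> m * e" by linarith
  obtain b' e' where b': "b = int b'" and e': "e = int e'"
    using \<open>b > 0\<close> assms(1) by (metis pos_int_cases)
  \<comment> \<open>Here \<open>2 * k = n - 2\<close> is the last vertex before the two shorter
    lists, and \<open>b \<le> m * e\<close> becomes the required
    \<open>b' \<le> Suc k * e'\<close>.\<close>
  obtain k where k: "m = int k + 1"
    using \<open>m \<ge> 1\<close> by (metis add.commute zle_iff_zadd)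
  let ?M = "\<lambda>j. L (int j)"
  have n1: "int (Suc (2 * k)) = n - 1" and n2: "int (Suc (Suc (2 * k))) = n"
    using n k by auto
  have "\<exists>S. path_colouring_end ?M b' (Suc (Suc (2 * k))) S"
  proof (rule path_colouring_end_exists)
    show "finite (?M 0)" "card (?M 0) = b'"
      using fin[of 0] L0 n k b' by auto
    show "finite (?M i) \<and> card (?M i) = 2 * b' + e'" if "1 \<le> i" "i \<le> 2 * k" for i
      using fin[of "int i"] Lmid[of "int i"] that n k b' e' assms(2) by auto
    show "finite (?M (Suc (2 * k)))" "finite (?M (Suc (Suc (2 * k))))"
      unfolding n1 n2 using fin n k by auto
    show "card (?M (Suc (2 * k))) = b' + e'" "card (?M (Suc (Suc (2 * k)))) = b' + e'"
      "2 * b' \<le> card (?M (Suc (2 * k)) \<union> ?M (Suc (Suc (2 * k))))"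
      unfolding n1 n2 using Ln Lun b' e' by auto
    have "int b' \<le> int (Suc k * e')"
      using be k b' e' by (simp add: algebra_simps)
    then show "b' \<le> Suc k * e'"
      by (simp only: of_nat_le_iff)
  qed
  then obtain c where c: "\<forall>j\<le>nat n. c j \<subseteq> ?M j \<and> finite (c j) \<and> card (c j) = b'"
    "\<forall>j<nat n. c j \<inter> c (Suc j) = {}"
    unfolding path_colouring_end_def n2[symmetric] nat_int by blast
  show ?thesis
    unfolding choosable_path_graph
  proof (intro exI[of _ "\<lambda>i. c (nat i)"] conjI ballI)
    fix i assume "i \<in> {0..n}"
    then have "nat i \<le> nat n" "int (nat i) = i" by auto
    then show "c (nat i) \<subseteq> L i" "finite (c (nat i))" "int (card (c (nat i))) = b"
      using c(1) b' by metis+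
  next
    fix i assume "i \<in> {0..n - 1}"
    then have "nat i < nat n" "nat (i + 1) = Suc (nat i)" by auto
    then show "c (nat i) \<inter> c (nat (i + 1)) = {}"
      using c(2) by simp
  qed
qed

end
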